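(* Let $k,t$ be positive integers and let $G$ be a finite graph with $\mathrm{mw}_2(G)\le k$ and $\omega(G)\le t$. Then $\chi(G)\le (t+1)!\,k^{2t-2}$.
   Context: $\omega(G)$ is the maximum size of a clique of $G$ and $\chi(G)$ its chromatic number. A merge sequence for a graph $G=(V,E)$ is a sequence $(\mathcal{P}_1,R_1),\dots,(\mathcal{P}_m,R_m)$ where: (1) each $\mathcal{P}_i$ is a partition of $V$, $\mathcal{P}_1$ is the partition into singletons, $\mathcal{P}_m=\{V\}$, and each part of $\mathcal{P}_i$ is a union of parts of $\mathcal{P}_{i-1}$; (2) $R_1\subseteq\dots\subseteq R_m\subseteq\binom{V}{2}$ are sets of unordered pairs of distinct vertices (resolved pairs); (3) for any two (possibly equal) parts $A,B\in\mathcal{P}_i$, the pairs $\{a,b\}$ with $a\in A$, $b\in B$, $a\neq b$, not in $R_i$ are either all edges or all non-edges of $G$. The radius-$r$ width of the sequence is the maximum, over steps $i\ge2$ and vertices $v$, of the number of parts of $\mathcal{P}_{i-1}$ containing a vertex at distance at most $r$ from $v$ in the graph $(V,R_i)$. $\mathrm{mw}_r(G)$ is the minimum radius-$r$ width of a merge sequence for $G$. *)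

theory Defs
  imports Main "HOL-Library.Disjoint_Sets"
begin

definition simple_graph :: "'a set \<Rightarrow> 'a set set \<Rightarrow> bool" where
  "simple_graph V E \<longleftrightarrow> finite V \<and>
     E \<subseteq> {{a, b} | a b. a \<in> V \<and> b \<in> V \<and> a \<noteq> b}"

definition clique_number :: "'a set \<Rightarrow> 'a set set \<Rightarrow> nat" where
  "clique_number V E = Sup {card C | C. C \<subseteq> V \<and>
      (\<forall>a\<in>C. \<forall>b\<in>C. a \<noteq> b \<longrightarrow> {a, b} \<in> E)}"

definition chromatic_number :: "'a set \<Rightarrow> 'a set set \<Rightarrow> nat" where
  "chromatic_number V E = Inf {c. \<exists>f :: 'a \<Rightarrow> nat. (\<forall>v\<in>V. f v < c) \<and>
      (\<forall>a\<in>V. \<forall>b\<in>V. {a, b} \<in> E \<longrightarrow> f a \<noteq> f b)}"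

fun dist_ball :: "'a set set \<Rightarrow> nat \<Rightarrow> 'a \<Rightarrow> 'a set" where
  "dist_ball R 0 v = {v}"
| "dist_ball R (Suc n) v = dist_ball R n v \<union> {u. \<exists>w\<in>dist_ball R n v. {w, u} \<in> R}"

text \<open>A merge sequence is a list; entry i (0-based) is the pair (P_{i+1}, R_{i+1}).\<close>
definition merge_sequence :: "'a set \<Rightarrow> 'a set set \<Rightarrow> ('a set set \<times> 'a set set) list \<Rightarrow> bool" where
  "merge_sequence V E S \<longleftrightarrow> S \<noteq> [] \<and>
     (\<forall>i<length S. partition_on V (fst (S ! i))) \<and>
     fst (S ! 0) = {{v} | v. v \<in> V} \<and>
     fst (S ! (length S - 1)) = {V} \<and>
     (\<forall>i. 0 < i \<and> i < length S \<longrightarrow>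
        (\<forall>B\<in>fst (S ! i). \<exists>Q \<subseteq> fst (S ! (i - 1)). B = \<Union>Q)) \<and>
     (\<forall>i. 0 < i \<and> i < length S \<longrightarrow> snd (S ! (i - 1)) \<subseteq> snd (S ! i)) \<and>
     (\<forall>i<length S. snd (S ! i) \<subseteq> {{a, b} | a b. a \<in> V \<and> b \<in> V \<and> a \<noteq> b}) \<and>
     (\<forall>i<length S. \<forall>A\<in>fst (S ! i). \<forall>B\<in>fst (S ! i).
        (\<forall>a\<in>A. \<forall>b\<in>B. a \<noteq> b \<and> {a, b} \<notin> snd (S ! i) \<longrightarrow> {a, b} \<in> E) \<or>
        (\<forall>a\<in>A. \<forall>b\<in>B. a \<noteq> b \<and> {a, b} \<notin> snd (S ! i) \<longrightarrow> {a, b} \<notin> E))"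

definition radius_width :: "'a set \<Rightarrow> nat \<Rightarrow> ('a set set \<times> 'a set set) list \<Rightarrow> nat" where
  "radius_width V r S = Sup {card {X \<in> fst (S ! (i - 1)). X \<inter> dist_ball (snd (S ! i)) r v \<noteq> {}}
       | i v. 0 < i \<and> i < length S \<and> v \<in> V}"

definition merge_width :: "nat \<Rightarrow> 'a set \<Rightarrow> 'a set set \<Rightarrow> nat" where
  "merge_width r V E = Inf {radius_width V r S | S. merge_sequence V E S}"

end

(* Induct on t, keeping the merge sequence of G but passing to vertex subsets U. If U has clique
   number t, cut U into the maximal parts of the merge sequence without a t-clique; inside each the
   induction hypothesis applies. Say that such a part X, contained in a part Y of the next step with
   a t-clique K, dies at that step.

   An edge from X to a part X' dying no earlier is late if it is unresolved when X dies. Then Y is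
   complete to its endpoint's part up to resolved pairs, and as K does not extend, the endpoint lies
   in a radius-1 ball around K. Hence X has at most tk late neighbours X', and tk + 1 colours separate
   all pairs joined by a late edge.

   Among the remaining edges, let s(v) be the last time just before a remaining edge at v is resolved,
   and take the maximal parts of the form P_s(v)(v). All neighbours of such a part lie in one ball of
   radius 2, so a part meets at most k - 1 others that are at least as late, and k colours suffice.

   This gives chi(t) <= (tk + 1) k chi(t - 1) <= (t + 1) k^2 chi(t - 1). *)
theory Submission
  imports Defs
begin

section \<open>Greedy colouring of degenerate graphs\<close>

text \<open>Greedy colouring in order of increasing \<open>rk\<close>: when \<open>x\<close> is
  inserted, all earlier vertices have rank at most \<open>rk x\<close>, so at most \<open>d\<close>
  neighbours of \<open>x\<close> are already coloured.\<close>

lemma degenerate_coloring: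
  fixes rk :: "'b \<Rightarrow> 'c::linorder"
  assumes "finite W"
    and "\<And>x y. adj x y \<Longrightarrow> adj y x"
    and "\<And>x. x \<in> W \<Longrightarrow> card {y \<in> W. adj x y \<and> y \<noteq> x \<and> rk y \<le> rk x} \<le> d"
  shows "\<exists>c :: 'b \<Rightarrow> nat. (\<forall>x\<in>W. c x < Suc d) \<and> (\<forall>x\<in>W. \<forall>y\<in>W. adj x y \<and> x \<noteq> y \<longrightarrow> c x \<noteq> c y)"
  using assms(1,3)
proof (induction W rule: finite_ranking_induct[where f = rk])
  case empty
  then show ?case by simp
next
  case (insert x S)
  show ?case
  proof (cases "x \<in> S")
    case True
    then show ?thesis using insert by (simp add: insert_absorb)
  next
    case False
    have "card {z \<in> S. adj y z \<and> z \<noteq> y \<and> rk z \<le> rk y} \<le> d" if "y \<in> S" for y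
    proof -
      have "card {z \<in> S. adj y z \<and> z \<noteq> y \<and> rk z \<le> rk y}
          \<le> card {z \<in> insert x S. adj y z \<and> z \<noteq> y \<and> rk z \<le> rk y}"
        using insert.hyps by (intro card_mono) auto
      also have "\<dots> \<le> d" using insert.prems that by blast
      finally show ?thesis .
    qed
    then obtain c :: "'b \<Rightarrow> nat" where c: "\<forall>x\<in>S. c x < Suc d"
      "\<forall>x\<in>S. \<forall>y\<in>S. adj x y \<and> x \<noteq> y \<longrightarrow> c x \<noteq> c y"
      using insert.IH by blast
    define N where "N = {y \<in> insert x S. adj x y \<and> y \<noteq> x \<and> rk y \<le> rk x}"
    have "card N \<le> d" unfolding N_def using insert.prems by blast
    moreover have "finite N" unfolding N_def using insert.hyps by simp
    ultimately have "card (c ` N) \<le> d" "finite (c ` N)"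
      using card_image_le[of N c] by auto
    then have "\<not> {..<Suc d} \<subseteq> c ` N"
      using card_mono[of "c ` N" "{..<Suc d}"] by auto
    then obtain a where a: "a < Suc d" "a \<notin> c ` N" by auto
    have "a \<noteq> c y" if "y \<in> S" "adj x y" for y
      using that a(2) insert.hyps False unfolding N_def by blast
    then show ?thesis using c a(1) False assms(2)
      by (intro exI[of _ "c(x := a)"]) (auto; metis)
  qed
qed

text \<open>Greedy colouring of the quotient of \<open>U\<close> by \<open>q\<close>, whose first
  component is a time. Negating the time puts later parts first, so only neighbours at least as late
  as the part itself count towards \<open>d\<close>.\<close>

lemma degenerate_quotient_coloring:
  fixes q :: "'a \<Rightarrow> nat \<times> 'b"
  assumes "finite U"
    and sym: "\<And>u w. D u w \<Longrightarrow> D w u"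
    and deg: "\<And>v. v \<in> U \<Longrightarrow> card {q w | u w. u \<in> U \<and> w \<in> U \<and> q u = q v \<and> D u w
                \<and> q w \<noteq> q v \<and> fst (q v) \<le> fst (q w)} \<le> d"
  shows "\<exists>c :: nat \<times> 'b \<Rightarrow> nat. (\<forall>v\<in>U. c (q v) < Suc d) \<and>
           (\<forall>u\<in>U. \<forall>w\<in>U. D u w \<and> q u \<noteq> q w \<longrightarrow> c (q u) \<noteq> c (q w))"
proof -
  define adj where "adj = (\<lambda>x y. \<exists>u\<in>U. \<exists>w\<in>U. q u = x \<and> q w = y \<and> D u w)"
  have "card {y \<in> q ` U. adj x y \<and> y \<noteq> x \<and> - int (fst y) \<le> - int (fst x)} \<le> d"
    if "x \<in> q ` U" for x
  proof -
    obtain v where v: "v \<in> U" "x = q v" using \<open>x \<in> q ` U\<close> by blast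
    let ?B = "{q w | u w. u \<in> U \<and> w \<in> U \<and> q u = q v \<and> D u w \<and> q w \<noteq> q v \<and> fst (q v) \<le> fst (q w)}"
    have "{y \<in> q ` U. adj x y \<and> y \<noteq> x \<and> - int (fst y) \<le> - int (fst x)} \<subseteq> ?B"
    proof
      fix y assume "y \<in> {y \<in> q ` U. adj x y \<and> y \<noteq> x \<and> - int (fst y) \<le> - int (fst x)}"
      then have y: "adj x y" "y \<noteq> q v" "fst (q v) \<le> fst y" using v(2) by auto
      from y(1) obtain u w where "u \<in> U" "w \<in> U" "q u = q v" "q w = y" "D u w"
        unfolding adj_def v(2) by blast
      with y(2,3) show "y \<in> ?B" by blast
    qed
    moreover have "finite ?B" by (rule finite_subset[of _ "q ` U"]) (use assms(1) in auto)
    ultimately show ?thesis using deg[OF v(1)] card_mono le_trans by blast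
  qed
  moreover have "adj y x" if "adj x y" for x y using that sym unfolding adj_def by blast
  ultimately obtain c :: "nat \<times> 'b \<Rightarrow> nat" where "\<forall>x\<in>q ` U. c x < Suc d"
    "\<forall>x\<in>q ` U. \<forall>y\<in>q ` U. adj x y \<and> x \<noteq> y \<longrightarrow> c x \<noteq> c y"
    using degenerate_coloring[of "q ` U" adj "\<lambda>x. - int (fst x)" d] assms(1) by auto
  then show ?thesis unfolding adj_def by (intro exI[of _ c]) blast
qed

section \<open>Merge sequences as functions of a step and a vertex\<close>

text \<open>\<open>cls i v\<close> is the part of \<open>v\<close> at step \<open>i\<close>, with
  steps counted from 0 and extended past \<open>m\<close>. As in the radius-2 width,
  \<open>width\<close> pairs \<open>cls i\<close> with the later \<open>R (Suc i)\<close>; the ball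
  of radius 2 is spelled out.\<close>

locale merge_chain =
  fixes V :: "'a set" and E :: "'a \<Rightarrow> 'a \<Rightarrow> bool"
    and cls :: "nat \<Rightarrow> 'a \<Rightarrow> 'a set" and R :: "nat \<Rightarrow> 'a \<Rightarrow> 'a \<Rightarrow> bool"
    and m k :: nat
  assumes finV: "finite V"
    and E_sym: "E a b \<Longrightarrow> E b a" and E_irrefl: "\<not> E a a"
    and cls_sub: "v \<in> V \<Longrightarrow> cls i v \<subseteq> V"
    and cls_self: "v \<in> V \<Longrightarrow> v \<in> cls i v"
    and cls_eq: "v \<in> V \<Longrightarrow> u \<in> cls i v \<Longrightarrow> cls i u = cls i v"
    and cls_mono: "v \<in> V \<Longrightarrow> i \<le> j \<Longrightarrow> cls i v \<subseteq> cls j v"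
    and cls_0: "v \<in> V \<Longrightarrow> cls 0 v = {v}"
    and cls_last: "v \<in> V \<Longrightarrow> cls m v = V"
    and R_sym: "R i a b \<Longrightarrow> R i b a"
    and R_mono: "R i a b \<Longrightarrow> i \<le> j \<Longrightarrow> R j a b"
    and homog: "\<lbrakk>a \<in> V; b \<in> V; a' \<in> cls i a; b' \<in> cls i b; a \<noteq> b; a' \<noteq> b';
        \<not> R i a b; \<not> R i a' b'; E a b\<rbrakk> \<Longrightarrow> E a' b'"
    and width: "v \<in> V \<Longrightarrow> card (cls i ` {u \<in> V. u = v \<or> R (Suc i) v u \<or>
        (\<exists>w\<in>V. R (Suc i) v w \<and> R (Suc i) w u)}) \<le> k"
begin

definition clique :: "'a set \<Rightarrow> bool" where
  "clique C \<longleftrightarrow> (\<forall>a\<in>C. \<forall>b\<in>C. a \<noteq> b \<longrightarrow> E a b)"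

definition ball2 :: "nat \<Rightarrow> 'a \<Rightarrow> 'a set" where
  "ball2 i v = {u \<in> V. u = v \<or> R i v u \<or> (\<exists>w\<in>V. R i v w \<and> R i w u)}"

lemma ball2_card: "v \<in> V \<Longrightarrow> card (cls i ` ball2 (Suc i) v) \<le> k"
  using width unfolding ball2_def by blast

lemma ball2_finite: "finite (ball2 i v)"
  unfolding ball2_def using finV by simp

lemma cls_eq_mono: "v \<in> V \<Longrightarrow> u \<in> V \<Longrightarrow> cls i u = cls i v \<Longrightarrow> i \<le> j \<Longrightarrow> cls j u = cls j v"
  by (metis cls_eq cls_mono cls_self in_mono)

text \<open>If \<open>c\<close> is constant on each class \<open>cls (p v) v\<close> then, for \<open>p v \<ge> i\<close>, the value \<open>c v\<close> can be
  recovered from \<open>cls i v\<close>.\<close>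
lemma factor_through_class:
  assumes "\<And>u v. v \<in> V \<Longrightarrow> u \<in> cls (p v) v \<Longrightarrow> c u = c v"
  shows "\<exists>g. \<forall>v\<in>V. i \<le> p v \<longrightarrow> c v = g (cls i v)"
proof (intro exI ballI impI)
  fix v assume v: "v \<in> V" "i \<le> p v"
  have "(SOME u. u \<in> cls i v) \<in> cls i v" using cls_self[OF v(1)] by (rule someI)
  then show "c v = (\<lambda>Z. c (SOME u. u \<in> Z)) (cls i v)"
    using assms[OF v(1)] cls_mono[OF v(1) v(2)] by (metis in_mono)
qed

end

section \<open>Late and early edges in a set of given clique number\<close>

text \<open>\<open>U\<close> has clique number exactly \<open>n\<close>. As
  \<open>2 \<le> n\<close>, a singleton holds no \<open>n\<close>-clique, so \<open>st v - 1\<close>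
  below is a genuine predecessor step.\<close>

locale saturated = merge_chain +
  fixes U :: "'a set" and n :: nat
  assumes UV: "U \<subseteq> V" and n2: "2 \<le> n"
    and om: "\<And>C. C \<subseteq> U \<Longrightarrow> clique C \<Longrightarrow> card C \<le> n"
    and attained: "\<exists>C\<subseteq>U. clique C \<and> card C = n"
begin

definition full :: "nat \<Rightarrow> 'a \<Rightarrow> bool" where
  "full i v \<longleftrightarrow> (\<exists>C\<subseteq>cls i v \<inter> U. clique C \<and> card C = n)"

text \<open>In the terms of the overview, \<open>X\<close> is \<open>cls (st v - 1) v\<close>,
  \<open>Y\<close> is \<open>cls (st v) v\<close>, and \<open>X\<close> dies at step
  \<open>st v\<close>.\<close>

definition st :: "'a \<Rightarrow> nat" where "st v = (LEAST i. full i v)"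

text \<open>\<open>cls (st v - 1) v\<close> is the largest part around \<open>v\<close> without an \<open>n\<close>-clique; recording its last
  time \<open>st v - 1\<close> (shifted by one) orders these parts for the degeneracy argument.\<close>
definition q :: "'a \<Rightarrow> nat \<times> 'a set" where "q v = (st v, cls (st v - 1) v)"

lemma finU: "finite U" using UV finV finite_subset by blast

lemma full_st: "v \<in> V \<Longrightarrow> full (st v) v"
proof -
  assume v: "v \<in> V"
  have "full m v" unfolding full_def cls_last[OF v] using attained UV by (simp add: Int_absorb1)
  then show ?thesis unfolding st_def by (rule LeastI)
qed

lemma not_full: "i < st v \<Longrightarrow> \<not> full i v"
  unfolding st_def using not_less_Least by blast

lemma st_pos: "v \<in> V \<Longrightarrow> 0 < st v"
proof (rule ccontr)
  assume v: "v \<in> V" "\<not> 0 < st v"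
  then have "full 0 v" using full_st by force
  then obtain C where C: "C \<subseteq> {v}" "card C = n" unfolding full_def cls_0[OF v(1)] by auto
  have "card C \<le> card {v}" using C(1) by (intro card_mono) auto
  with C(2) n2 show False by simp
qed

text \<open>With its converse \<open>q_eq_cls\<close>, this makes the fibres of \<open>q\<close> on
  \<open>V\<close> exactly the parts \<open>cls (st v - 1) v\<close>. The parts of \<open>u\<close>
  and \<open>v\<close> agree at steps \<open>st v - 1\<close> and \<open>st v\<close>, and lacking
  an \<open>n\<close>-clique passes down to the smaller parts around \<open>u\<close>.\<close>

lemma q_eqI:
  assumes v: "v \<in> V" and u: "u \<in> cls (st v - 1) v"
  shows "q u = q v"
proof -
  have uV: "u \<in> V" using cls_sub v u by blast
  have c: "cls (st v - 1) u = cls (st v - 1) v" using cls_eq[OF v u] .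
  then have "cls (st v) u = cls (st v) v" using cls_eq_mono[OF v uV c] by simp
  then have f: "full (st v) u" using full_st[OF v] unfolding full_def by simp
  have nf: "\<not> full (st v - 1) u" using not_full[of "st v - 1" v] st_pos[OF v] c
    unfolding full_def by simp
  have "\<not> full i u" if "i < st v" for i
  proof
    assume "full i u"
    moreover have "cls i u \<subseteq> cls (st v - 1) u" using cls_mono[OF uV] that by simp
    ultimately have "full (st v - 1) u" unfolding full_def by blast
    with nf show False by simp
  qed
  then have "st u = st v" unfolding st_def[of u] using f
    by (intro Least_equality) (auto simp: not_less[symmetric])
  with c show ?thesis unfolding q_def by simp
qed

lemma q_eq_cls: "q u = q v \<Longrightarrow> v \<in> V \<Longrightarrow> u \<in> V \<Longrightarrow> st v - 1 \<le> j \<Longrightarrow> cls j u = cls j v"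
  unfolding q_def using cls_eq_mono by (metis Pair_inject)

lemma q_eq_small: "v \<in> V \<Longrightarrow> i < st v \<Longrightarrow> u \<in> cls i v \<Longrightarrow> q u = q v"
  using q_eqI cls_mono[of v i "st v - 1"] by (metis Suc_diff_1 in_mono less_Suc_eq_le st_pos)

text \<open>Otherwise homogeneity makes \<open>w\<close> adjacent to all of \<open>K\<close>, giving a clique of size \<open>n + 1\<close>.\<close>
lemma late_near_clique:
  assumes "v \<in> V" "K \<subseteq> cls j v \<inter> U" "clique K" "card K = n"
    and "u \<in> U" "w \<in> U" "cls j u = cls j v" "E u w" "\<not> R j u w"
  shows "\<exists>a\<in>K. w = a \<or> R j a w"
proof (rule ccontr)
  assume neg: "\<not> ?thesis"
  have "E a w" if "a \<in> K" for a
  proof (rule homog[of u w a j w])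
    show "u \<in> V" "w \<in> V" using assms UV by auto
    show "a \<in> cls j u" using assms that by auto
    show "w \<in> cls j w" using cls_self \<open>w \<in> V\<close> .
    show "u \<noteq> w" using assms E_irrefl by auto
  qed (use assms neg that in auto)
  then have "clique (insert w K)" using assms(3) E_sym unfolding clique_def by blast
  then have "card (insert w K) \<le> n" using om[of "insert w K"] assms by blast
  moreover have "w \<notin> K" using neg by blast
  moreover have "finite K" using assms(2) finU by (meson finite_Int finite_subset)
  ultimately show False using assms(4) by simp
qed

text \<open>A late neighbour \<open>w\<close> lies in a ball around one of the \<open>n\<close>
  vertices of a clique \<open>K\<close> in \<open>cls (st v) v\<close>. These balls meet at most
  \<open>n * k\<close> classes of step \<open>st v - 1\<close>, and the class of \<open>w\<close>
  among them determines \<open>q w\<close>, because the part of \<open>w\<close> dies no earlier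
  than that of \<open>v\<close>.\<close>

lemma late_coloring:
  "\<exists>c :: nat \<times> 'a set \<Rightarrow> nat. (\<forall>v\<in>U. c (q v) < Suc (n * k)) \<and>
     (\<forall>u\<in>U. \<forall>w\<in>U. (E u w \<and> \<not> R (min (st u) (st w)) u w) \<and> q u \<noteq> q w \<longrightarrow> c (q u) \<noteq> c (q w))"
proof (rule degenerate_quotient_coloring[OF finU])
  fix u w assume "E u w \<and> \<not> R (min (st u) (st w)) u w"
  then show "E w u \<and> \<not> R (min (st w) (st u)) w u" using E_sym R_sym by (metis min.commute)
next
  fix v assume "v \<in> U"
  then have v: "v \<in> V" using UV by blast
  obtain i where i: "st v = Suc i" using st_pos[OF v] gr0_implies_Suc by blast
  obtain K where K: "K \<subseteq> cls (Suc i) v \<inter> U" "clique K" "card K = n"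
    using full_st[OF v] unfolding full_def i by blast
  have finK: "finite K" using K(1) finU by (meson finite_Int finite_subset)
  have KV: "K \<subseteq> V" using K(1) UV by blast
  obtain g where g: "\<And>w. w \<in> V \<Longrightarrow> i \<le> st w - 1 \<Longrightarrow> q w = g (cls i w)"
    using factor_through_class[of "\<lambda>w. st w - 1" q i] q_eqI by blast
  let ?L = "{q w | u w. u \<in> U \<and> w \<in> U \<and> q u = q v \<and> (E u w \<and> \<not> R (min (st u) (st w)) u w)
      \<and> q w \<noteq> q v \<and> fst (q v) \<le> fst (q w)}"
  let ?B = "\<Union>a\<in>K. cls i ` ball2 (Suc i) a"
  have "?L \<subseteq> g ` ?B"
  proof
    fix x assume "x \<in> ?L"
    then obtain u w where uw: "x = q w" "u \<in> U" "w \<in> U" "q u = q v" "E u w"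
      "\<not> R (min (st u) (st w)) u w" "fst (q v) \<le> fst (q w)" by blast
    have s: "st u = Suc i" "Suc i \<le> st w" using uw(4,7) i unfolding q_def by auto
    have uV: "u \<in> V" "w \<in> V" using uw UV by auto
    have "cls (Suc i) u = cls (Suc i) v" using q_eq_cls[OF uw(4) v uV(1)] i by simp
    then obtain a where "a \<in> K" "w = a \<or> R (Suc i) a w"
      using late_near_clique[OF v K uw(2,3) _ uw(5)] uw(6) s by (auto simp: min_def)
    then have "w \<in> ball2 (Suc i) a" unfolding ball2_def using uV by blast
    with \<open>a \<in> K\<close> have "cls i w \<in> ?B" by blast
    then show "x \<in> g ` ?B" using g[OF uV(2)] s(2) uw(1) by auto
  qed
  moreover have "finite ?B" using finK ball2_finite by blast
  ultimately have "card ?L \<le> card ?B"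
    using card_mono[of "g ` ?B" ?L] card_image_le[of ?B g] by (meson finite_imageI le_trans)
  also have "\<dots> \<le> (\<Sum>a\<in>K. card (cls i ` ball2 (Suc i) a))" using finK by (rule card_UN_le)
  also have "\<dots> \<le> card K * k" using ball2_card KV by (intro sum_bounded_above[where K=k, simplified]) auto
  finally show "card ?L \<le> n * k" using K(3) by simp
qed

text \<open>The edges \<open>F\<close> left by \<open>b\<close> are resolved before either endpoint's part fills up. The parts of
  \<open>u\<close> and \<open>w\<close> just before \<open>{u, w}\<close> was resolved, at time \<open>\<rho> u w\<close>, are completely resolved to each
  other once all \<open>F\<close>-edges at the first part are resolved, so all neighbours of that part lie in a
  single ball of radius 2.\<close>
lemma early_coloring:
  fixes b :: "nat \<times> 'a set \<Rightarrow> nat"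
  assumes b: "\<And>u w. \<lbrakk>u \<in> U; w \<in> U; E u w; \<not> R (min (st u) (st w)) u w; q u \<noteq> q w\<rbrakk>
    \<Longrightarrow> b (q u) \<noteq> b (q w)" and k: "0 < k"
  shows "\<exists>c :: 'a \<Rightarrow> nat. (\<forall>v\<in>U. c v < k) \<and>
     (\<forall>u\<in>U. \<forall>w\<in>U. E u w \<and> q u \<noteq> q w \<and> b (q u) = b (q w) \<longrightarrow> c u \<noteq> c w)"
proof -
  define F where "F u w \<longleftrightarrow> u \<in> U \<and> w \<in> U \<and> E u w \<and> q u \<noteq> q w \<and> b (q u) = b (q w)" for u w
  \<comment> \<open>By the shift, an \<open>F\<close>-pair is resolved at step
    \<open>Suc (\<rho> u w)\<close> and, if \<open>\<rho> u w\<close> is positive, unresolved at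
    \<open>\<rho> u w\<close>. The value 0 also covers pairs resolved from the start, hence the
    separate treatment of 0 below.\<close>
  define \<rho> where "\<rho> u w = (LEAST s. R (Suc s) u w)" for u w
  \<comment> \<open>\<open>T v\<close> is the step of the maximal part around \<open>v\<close> from
    the overview. Counting edges at every \<open>u\<close> whose part contains \<open>v\<close>, not
    only edges at \<open>v\<close>, makes \<open>T\<close> constant on that part. The 0 keeps
    \<open>M v\<close> nonempty.\<close>
  define M where "M v = insert 0 {\<rho> u w | u w. F u w \<and> v \<in> cls (\<rho> u w) u}" for v
  define T where "T v = Max (M v)" for v
  define p where "p v = (T v, cls (T v) v)" for v
  have F_sym: "F w u" if "F u w" for u w using that E_sym unfolding F_def by auto
  have FV: "u \<in> V" "w \<in> V" if "F u w" for u w using that UV unfolding F_def by auto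
  have F_res: "R (min (st u) (st w)) u w" if "F u w" for u w
    using that b unfolding F_def by blast
  have Suc_min: "Suc (min (st u) (st w) - 1) = min (st u) (st w)" if "F u w" for u w
    using st_pos FV[OF that] by simp
  have \<rho>_res: "R (Suc (\<rho> u w)) u w" if "F u w" for u w
    unfolding \<rho>_def by (rule LeastI[of _ "min (st u) (st w) - 1"])
      (use Suc_min[OF that] F_res[OF that] in simp)
  have "\<rho> u w \<le> min (st u) (st w) - 1" if "F u w" for u w
    unfolding \<rho>_def by (rule Least_le) (use Suc_min[OF that] F_res[OF that] in simp)
  then have \<rho>_less: "\<rho> u w < st u" "\<rho> u w < st w" if "F u w" for u w
    using that st_pos[OF FV(1)[OF that]] st_pos[OF FV(2)[OF that]] by fastforce+
  have \<rho>_unres: "\<not> R (\<rho> u w) u w" if "F u w" "0 < \<rho> u w" for u w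
    using not_less_Least[of "\<rho> u w - 1" "\<lambda>s. R (Suc s) u w"] that unfolding \<rho>_def by auto
  have M_fin: "finite (M v)" for v
  proof -
    have "M v \<subseteq> insert 0 ((\<lambda>(u, w). \<rho> u w) ` (U \<times> U))" unfolding M_def F_def by auto
    then show ?thesis using finU finite_subset by blast
  qed
  have T_ge: "\<rho> u w \<le> T v" if "F u w" "v \<in> cls (\<rho> u w) u" for u w v
    unfolding T_def using M_fin that by (intro Max_ge) (auto simp: M_def)
  have T_in: "T v \<in> M v" for v unfolding T_def using M_fin by (intro Max_in) (auto simp: M_def)
  \<comment> \<open>A positive \<open>T v\<close> lies in \<open>M u\<close> for every
    \<open>u\<close> in \<open>cls (T v) v\<close>. Conversely, once \<open>T v \<le> T u\<close>,
    the part of \<open>u\<close> at step \<open>T u\<close> contains \<open>v\<close>, so a positive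
    \<open>T u\<close> lies in \<open>M v\<close>.\<close>
  have p_eq: "p u = p v" if v: "v \<in> V" and u: "u \<in> cls (T v) v" for u v
  proof -
    have uV: "u \<in> V" using cls_sub v u by blast
    have c: "cls (T v) u = cls (T v) v" using cls_eq[OF v u] .
    have le: "T v \<le> T u"
    proof (cases "T v = 0")
      case False
      then obtain x y where xy: "F x y" "v \<in> cls (\<rho> x y) x" "T v = \<rho> x y"
        using T_in[of v] unfolding M_def by auto
      then have "u \<in> cls (\<rho> x y) x" using u cls_eq[OF FV(1)] by metis
      then show ?thesis using T_ge[OF xy(1)] xy(3) by simp
    qed simp
    have "T u \<le> T v"
    proof (cases "T u = 0")
      case False
      then obtain x y where xy: "F x y" "u \<in> cls (\<rho> x y) x" "T u = \<rho> x y"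
        using T_in[of u] unfolding M_def by auto
      have "cls (T u) v = cls (T u) u" using cls_eq_mono[OF v uV c le] by simp
      also have "\<dots> = cls (\<rho> x y) x" using xy cls_eq[OF FV(1)] by metis
      finally have "v \<in> cls (\<rho> x y) x" using cls_self[OF v] by metis
      then show ?thesis using T_ge[OF xy(1)] xy(3) by simp
    qed simp
    with le c show ?thesis unfolding p_def by simp
  qed
  have F_T: "R (Suc (T u)) u w" if "F u w" for u w
    using T_ge[OF that cls_self[OF FV(1)[OF that]]] \<rho>_res[OF that] R_mono by simp
  have "\<exists>c :: nat \<times> 'a set \<Rightarrow> nat. (\<forall>v\<in>U. c (p v) < Suc (k - 1)) \<and>
     (\<forall>u\<in>U. \<forall>w\<in>U. F u w \<and> p u \<noteq> p w \<longrightarrow> c (p u) \<noteq> c (p w))"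
  proof (rule degenerate_quotient_coloring[OF finU F_sym])
    fix v assume "v \<in> U"
    then have v: "v \<in> V" using UV by blast
    let ?s = "T v"
    let ?L = "{p w | u w. u \<in> U \<and> w \<in> U \<and> p u = p v \<and> F u w \<and> p w \<noteq> p v \<and> fst (p v) \<le> fst (p w)}"
    show "card ?L \<le> k - 1"
    proof (cases "?L = {}")
      case True
      then show ?thesis by (metis card.empty zero_le)
    next
      case False
      then obtain u w where u: "p u = p v" "F u w" by blast
      have uV: "u \<in> V" using FV(1)[OF u(2)] .
      have Tu: "T u = ?s" "cls ?s u = cls ?s v" using u(1) unfolding p_def by (metis Pair_inject)+
      \<comment> \<open>If \<open>T u\<close> is 0, the edge \<open>{u, w}\<close> itself is a
        witness, as \<open>\<rho> u w\<close> is at most \<open>T u\<close>.\<close>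
      have "\<exists>x y. F x y \<and> u \<in> cls (\<rho> x y) x \<and> T u = \<rho> x y"
      proof (cases "T u = 0")
        case True
        then have "\<rho> u w = 0" using T_ge[OF u(2) cls_self[OF uV]] by simp
        then show ?thesis using True u(2) cls_self[OF uV] by metis
      next
        case False
        then show ?thesis using T_in[of u] unfolding M_def by auto
      qed
      then obtain x y where "F x y" "u \<in> cls (\<rho> x y) x" "T u = \<rho> x y" by blast
      then have xy: "F x y" "u \<in> cls ?s x" "?s = \<rho> x y" using Tu(1) by (metis, metis, metis)
      have clsx: "cls ?s x = cls ?s v" using xy(2) cls_eq[OF FV(1)[OF xy(1)]] Tu(2) by metis
      \<comment> \<open>\<open>y\<close> is the centre of the ball. An edge \<open>{u', y}\<close>
        is again in \<open>F\<close>, since \<open>q u' = q x\<close>, so \<open>F_T\<close>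
        resolves it. A non-edge must be resolved by step \<open>T v\<close>: homogeneity would
        otherwise copy the unresolved edge \<open>{x, y}\<close> to it, and if
        \<open>T v = 0\<close> then \<open>u' = x\<close>. Any \<open>F\<close>-edge at
        \<open>u'\<close> thus ends within distance 2 of \<open>y\<close>.\<close>
      have near: "R (Suc ?s) y u'" if u': "u' \<in> U" "p u' = p v" for u'
      proof -
        have u'V: "u' \<in> V" using u' UV by blast
        have Tu': "T u' = ?s" "cls ?s u' = cls ?s v" using u'(2) unfolding p_def by (metis Pair_inject)+
        have mem: "u' \<in> cls ?s x" using clsx Tu'(2) cls_self[OF u'V] by metis
        have q': "q u' = q x"
          using q_eq_small[OF FV(1)[OF xy(1)] _ mem] \<rho>_less[OF xy(1)] xy(3) by simp
        show ?thesis
        proof (cases "E u' y")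
          case True
          then have "F u' y" using xy(1) u' q' unfolding F_def by simp
          then show ?thesis using F_T Tu'(1) R_sym by metis
        next
          case nE: False
          show ?thesis
          proof (cases "?s = 0")
            case True
            then have "u' = x" using mem cls_0[OF FV(1)[OF xy(1)]] by simp
            then show ?thesis using nE xy(1) unfolding F_def by simp
          next
            case False
            have "R ?s u' y"
            proof (rule ccontr)
              assume "\<not> R ?s u' y"
              moreover have "\<not> R ?s x y" using \<rho>_unres[OF xy(1)] False xy(3) by simp
              moreover have "x \<noteq> y" "u' \<noteq> y" "E x y" using xy(1) q' unfolding F_def by auto
              ultimately have "E u' y"
                using homog[OF FV[OF xy(1)] mem cls_self[OF FV(2)[OF xy(1)]]] by blast
              with nE show False by simp
            qed
            then show ?thesis using R_sym R_mono by (meson le_SucI order_refl)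
          qed
        qed
      qed
      have yV: "y \<in> V" using FV xy(1) by blast
      let ?B = "cls ?s ` ball2 (Suc ?s) y"
      obtain g where g: "\<And>w. w \<in> V \<Longrightarrow> ?s \<le> T w \<Longrightarrow> p w = g (cls ?s w)"
        using factor_through_class[of T p ?s] p_eq by blast
      have "u \<in> ball2 (Suc ?s) y"
        using near[of u] u FV[OF u(2)] unfolding ball2_def F_def by blast
      \<comment> \<open>The part of \<open>v\<close> itself meets the ball; discounting it leaves
        \<open>k - 1\<close> others, hence \<open>k\<close> colours.\<close>
      then have vB: "cls ?s v \<in> ?B" using Tu(2) by (metis imageI)
      have "?L \<subseteq> g ` (?B - {cls ?s v})"
      proof
        fix z assume "z \<in> ?L"
        then obtain u' w' where uw: "z = p w'" "u' \<in> U" "w' \<in> U" "p u' = p v" "F u' w'"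
          "p w' \<noteq> p v" "fst (p v) \<le> fst (p w')" by blast
        have w'V: "u' \<in> V" "w' \<in> V" using uw UV by auto
        have "T u' = ?s" using uw(4) unfolding p_def by (metis Pair_inject)
        then have "R (Suc ?s) u' w'" using F_T[OF uw(5)] by simp
        then have "w' \<in> ball2 (Suc ?s) y" using near[OF uw(2,4)] w'V unfolding ball2_def by blast
        moreover have gw: "p w' = g (cls ?s w')" using g[OF w'V(2)] uw(7) unfolding p_def by simp
        moreover have "cls ?s w' \<noteq> cls ?s v" using gw g[OF v] uw(6) by auto
        ultimately show "z \<in> g ` (?B - {cls ?s v})" using uw(1) by blast
      qed
      moreover have fB: "finite ?B" using ball2_finite by blast
      ultimately have "card ?L \<le> card (?B - {cls ?s v})"
        by (meson card_image_le card_mono finite_Diff finite_imageI le_trans)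
      also have "\<dots> = card ?B - 1" using vB by (rule card_Diff_singleton)
      also have "\<dots> \<le> k - 1" using ball2_card[OF yV] by (rule diff_le_mono)
      finally show ?thesis .
    qed
  qed
  then obtain c :: "nat \<times> 'a set \<Rightarrow> nat" where c: "\<forall>v\<in>U. c (p v) < k"
    "\<forall>u\<in>U. \<forall>w\<in>U. F u w \<and> p u \<noteq> p w \<longrightarrow> c (p u) \<noteq> c (p w)" using k by auto
  \<comment> \<open>An \<open>F\<close>-edge inside one part \<open>cls (T u) u\<close> would give
    \<open>q w = q u\<close>, because \<open>T u\<close> is less than \<open>st u\<close>.\<close>
  have "p u \<noteq> p w" if "F u w" for u w
  proof
    assume eq: "p u = p w"
    have w: "w \<in> cls (T u) u" using eq cls_self[OF FV(2)[OF that]] unfolding p_def by (metis Pair_inject)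
    have "T u < st u"
    proof (cases "T u = 0")
      case False
      then obtain x y where xy: "F x y" "u \<in> cls (\<rho> x y) x" "T u = \<rho> x y"
        using T_in[of u] unfolding M_def by auto
      have "q u = q x" using q_eq_small[OF FV(1)[OF xy(1)] _ xy(2)] \<rho>_less[OF xy(1)] by simp
      then show ?thesis using xy(3) \<rho>_less(1)[OF xy(1)] unfolding q_def by simp
    qed (use st_pos[OF FV(1)[OF that]] in simp)
    then have "q w = q u" using q_eq_small[OF FV(1)[OF that] _ w] by simp
    then show False using that unfolding F_def by simp
  qed
  then have "\<forall>u\<in>U. \<forall>w\<in>U. E u w \<and> q u \<noteq> q w \<and> b (q u) = b (q w) \<longrightarrow> c (p u) \<noteq> c (p w)"
    using c(2) unfolding F_def by blast
  then show ?thesis using c(1) by (intro exI[of _ "\<lambda>v. c (p v)"]) simp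
qed

lemma fiber_clique:
  assumes "v \<in> V" "C \<subseteq> {u \<in> U. q u = q v}" "clique C"
  shows "card C \<noteq> n"
proof
  assume "card C = n"
  moreover have "C \<subseteq> cls (st v - 1) v \<inter> U"
  proof
    fix u assume "u \<in> C"
    then have u: "u \<in> U" "q u = q v" "u \<in> V" using assms UV by auto
    have "cls (st v - 1) u = cls (st v - 1) v" using q_eq_cls[OF u(2) assms(1) u(3)] by simp
    then show "u \<in> cls (st v - 1) v \<inter> U" using cls_self[OF u(3)] u(1) by auto
  qed
  ultimately have "full (st v - 1) v" unfolding full_def using assms by blast
  then show False using not_full[of "st v - 1" v] st_pos[OF assms(1)] by simp
qed

end

section \<open>Induction on the clique number\<close>

context merge_chain
begin

definition colorable :: "'a set \<Rightarrow> nat \<Rightarrow> bool" where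
  "colorable U c \<longleftrightarrow> (\<exists>f :: 'a \<Rightarrow> nat. (\<forall>v\<in>U. f v < c) \<and> (\<forall>a\<in>U. \<forall>b\<in>U. E a b \<longrightarrow> f a \<noteq> f b))"

lemma colorable_mono: "colorable U c \<Longrightarrow> c \<le> d \<Longrightarrow> colorable U d"
  unfolding colorable_def by (meson order_less_le_trans)

lemma colorableI:
  assumes "finite C" "f ` U \<subseteq> C" "\<And>a b. \<lbrakk>a \<in> U; b \<in> U; E a b\<rbrakk> \<Longrightarrow> f a \<noteq> f b"
  shows "colorable U (card C)"
proof -
  obtain h where h: "bij_betw h C {0..<card C}" using ex_bij_betw_finite_nat[OF assms(1)] by blast
  have "h (f a) \<noteq> h (f b)" if "a \<in> U" "b \<in> U" "E a b" for a b
    using assms(2,3) that h unfolding bij_betw_def inj_on_def by blast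
  moreover have "h (f a) < card C" if "a \<in> U" for a
    using assms(2) that h unfolding bij_betw_def by fastforce
  ultimately show ?thesis unfolding colorable_def by (intro exI[of _ "h \<circ> f"]) simp
qed

text \<open>The colour of \<open>v\<close> is a triple: an edge between different fibres of
  \<open>q\<close> is separated by \<open>b\<close> or by \<open>c\<close>, and an edge inside a
  fibre by the colouring that \<open>IH\<close> supplies, as a fibre contains no
  \<open>n\<close>-clique.\<close>

lemma colorable_step:
  assumes "saturated V E cls R m k U n" and k: "0 < k"
    and IH: "\<And>W. \<lbrakk>W \<subseteq> V; \<And>C. C \<subseteq> W \<Longrightarrow> clique C \<Longrightarrow> card C < n\<rbrakk> \<Longrightarrow> colorable W N"
  shows "colorable U (Suc (n * k) * (k * N))"
proof -
  interpret saturated V E cls R m k U n by fact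
  obtain b :: "nat \<times> 'a set \<Rightarrow> nat" where b: "\<And>v. v \<in> U \<Longrightarrow> b (q v) < Suc (n * k)"
    "\<And>u w. \<lbrakk>u \<in> U; w \<in> U; E u w; \<not> R (min (st u) (st w)) u w; q u \<noteq> q w\<rbrakk> \<Longrightarrow> b (q u) \<noteq> b (q w)"
    using late_coloring by blast
  obtain c :: "'a \<Rightarrow> nat" where c: "\<And>v. v \<in> U \<Longrightarrow> c v < k"
    "\<And>u w. \<lbrakk>u \<in> U; w \<in> U; E u w; q u \<noteq> q w; b (q u) = b (q w)\<rbrakk> \<Longrightarrow> c u \<noteq> c w"
    using early_coloring[of b, OF b(2) k] by blast
  define good where "good x g \<longleftrightarrow> (\<forall>v\<in>{u \<in> U. q u = x}. g v < N) \<and>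
      (\<forall>a\<in>{u \<in> U. q u = x}. \<forall>b\<in>{u \<in> U. q u = x}. E a b \<longrightarrow> g a \<noteq> g b)"
    for x and g :: "'a \<Rightarrow> nat"
  have fiber: "colorable {u \<in> U. q u = q v} N" if "v \<in> U" for v
  proof (rule IH)
    fix C assume C: "C \<subseteq> {u \<in> U. q u = q v}" "clique C"
    then have "card C \<le> n" using om by blast
    moreover have "card C \<noteq> n" using fiber_clique C that UV by blast
    ultimately show "card C < n" by simp
  qed (use UV in blast)
  have "\<forall>x\<in>q ` U. \<exists>g. good x g"
    using fiber unfolding colorable_def good_def[symmetric] by blast
  from bchoice[OF this] obtain f where f: "\<forall>x\<in>q ` U. good x (f x)" ..
  let ?C = "{..<Suc (n * k)} \<times> {..<k} \<times> {..<N}"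
  have "colorable U (card ?C)"
  proof (rule colorableI[of ?C "\<lambda>v. (b (q v), c v, f (q v) v)"])
    show "(\<lambda>v. (b (q v), c v, f (q v) v)) ` U \<subseteq> ?C" using b(1) c(1) f unfolding good_def by auto
    show "(b (q u), c u, f (q u) u) \<noteq> (b (q w), c w, f (q w) w)"
      if "u \<in> U" "w \<in> U" "E u w" for u w
      using that c(2)[OF that] f unfolding good_def by (cases "q u = q w") auto
  qed simp
  moreover have "card ?C = Suc (n * k) * (k * N)" by (simp add: card_cartesian_product)
  ultimately show ?thesis by simp
qed

text \<open>Writing the clique bound as \<open>Suc t\<close> starts the induction at edgeless sets
  and avoids truncated subtraction in the exponent.\<close>

lemma chi_bound:
  assumes "0 < k"
  shows "\<lbrakk>U \<subseteq> V; \<And>C. C \<subseteq> U \<Longrightarrow> clique C \<Longrightarrow> card C \<le> Suc t\<rbrakk>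
    \<Longrightarrow> colorable U (fact (t + 2) * k ^ (2 * t))"
proof (induction t arbitrary: U)
  case 0
  have "\<not> E a b" if "a \<in> U" "b \<in> U" for a b
  proof
    assume "E a b"
    then have "clique {a, b}" "a \<noteq> b" using E_sym E_irrefl unfolding clique_def by auto
    then show False using 0(2)[of "{a, b}"] that by auto
  qed
  then show ?case unfolding colorable_def by (intro exI[of _ "\<lambda>_. 0"]) simp
next
  case (Suc t)
  let ?N = "fact (t + 2) * k ^ (2 * t) :: nat"
  have fact_eq: "fact (Suc t + 2) = (t + 3) * fact (t + 2)"
    using fact_Suc[of "t + 2", where 'a = nat] by (simp del: fact_Suc add: eval_nat_numeral)
  have bound: "Suc (Suc (Suc t) * k) * (k * ?N) \<le> fact (Suc t + 2) * k ^ (2 * Suc t)"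
  proof -
    \<comment> \<open>The summand 1 is absorbed because \<open>1 \<le> k\<close>, which gives the
      factor \<open>t + 3\<close> of the next factorial.\<close>
    have "Suc (Suc (Suc t) * k) \<le> (t + 3) * k" using assms by (simp add: algebra_simps)
    then have "Suc (Suc (Suc t) * k) * (k * ?N) \<le> (t + 3) * k * (k * ?N)" by (rule mult_le_mono1)
    also have "\<dots> = fact (Suc t + 2) * k ^ (2 * Suc t)" unfolding fact_eq
      by (simp add: power_add power2_eq_square mult_ac del: fact_Suc)
    finally show ?thesis .
  qed
  show ?case
  proof (cases "\<exists>C\<subseteq>U. clique C \<and> card C = Suc (Suc t)")
    case True
    then have "saturated V E cls R m k U (Suc (Suc t))"
      using Suc.prems by unfold_locales auto
    then have "colorable U (Suc (Suc (Suc t) * k) * (k * ?N))"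
      using assms by (rule colorable_step) (use Suc.IH in \<open>simp add: less_Suc_eq_le\<close>)
    then show ?thesis using bound by (rule colorable_mono)
  next
    case False
    have "card C \<le> Suc t" if "C \<subseteq> U" "clique C" for C
      using False Suc.prems(2)[OF that] that by (metis le_SucE)
    then have "colorable U ?N" using Suc.IH Suc.prems(1) by blast
    moreover have "1 * (1 * ?N) \<le> Suc (Suc (Suc t) * k) * (k * ?N)"
      using assms by (intro mult_le_mono) auto
    then have "?N \<le> fact (Suc t + 2) * k ^ (2 * Suc t)"
      unfolding mult_1 using bound by (rule le_trans)
    ultimately show ?thesis by (rule colorable_mono)
  qed
qed

end

section \<open>From merge sequences as lists to step functions\<close>

lemma partition_class:
  assumes "partition_on V P" "X \<in> P" "v \<in> X"
  shows "\<Union>{Y \<in> P. v \<in> Y} = X"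
proof -
  have "{Y \<in> P. v \<in> Y} = {X}" using assms unfolding partition_on_def disjoint_def by blast
  then show ?thesis by simp
qed

text \<open>Ensures that the infimum in \<open>merge_width\<close> is attained. Resolving all pairs
  from the start makes homogeneity vacuous; \<open>{V}\<close> is a partition only for nonempty
  \<open>V\<close>.\<close>

lemma merge_sequence_exists:
  assumes "simple_graph V E" "V \<noteq> {}"
  shows "\<exists>S. merge_sequence V E S"
proof
  let ?R = "{{a, b} | a b. a \<in> V \<and> b \<in> V \<and> a \<noteq> b}"
  let ?S = "[({{v} | v. v \<in> V}, ?R), ({V}, ?R)]"
  have "partition_on V {{v} | v. v \<in> V}" unfolding partition_on_def disjoint_def by auto
  moreover have "partition_on V {V}" using assms(2) unfolding partition_on_def disjoint_def by auto
  moreover have "V = \<Union>{{v} | v. v \<in> V}" by auto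
  ultimately show "merge_sequence V E ?S" unfolding merge_sequence_def
    by (auto simp: less_Suc_eq nth_Cons' less_2_cases_iff)
qed

text \<open>Clamping the index by \<open>min i m\<close> repeats the last entry forever, which makes
  the step functions total.\<close>

lemma merge_sequence_chain:
  assumes G: "simple_graph V E" and S: "merge_sequence V E S"
    and w: "radius_width V 2 S \<le> k" and k: "0 < k"
  defines "m \<equiv> length S - 1"
  shows "merge_chain V (\<lambda>a b. {a, b} \<in> E) (\<lambda>i v. \<Union>{X \<in> fst (S ! min i m). v \<in> X})
    (\<lambda>i a b. {a, b} \<in> snd (S ! min i m)) m k"
proof -
  define P where "P i = fst (S ! min i m)" for i
  define R where "R i = snd (S ! min i m)" for i
  have S_ne: "S \<noteq> []"
    and S_part: "\<forall>i<length S. partition_on V (fst (S ! i))"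
    and S_first: "fst (S ! 0) = {{v} | v. v \<in> V}"
    and S_last: "fst (S ! (length S - 1)) = {V}"
    and S_coarser: "\<forall>i. 0 < i \<and> i < length S \<longrightarrow>
        (\<forall>B\<in>fst (S ! i). \<exists>Q \<subseteq> fst (S ! (i - 1)). B = \<Union>Q)"
    and S_incr: "\<forall>i. 0 < i \<and> i < length S \<longrightarrow> snd (S ! (i - 1)) \<subseteq> snd (S ! i)"
    and S_hom: "\<forall>i<length S. \<forall>A\<in>fst (S ! i). \<forall>B\<in>fst (S ! i).
        (\<forall>a\<in>A. \<forall>b\<in>B. a \<noteq> b \<and> {a, b} \<notin> snd (S ! i) \<longrightarrow> {a, b} \<in> E) \<or>
        (\<forall>a\<in>A. \<forall>b\<in>B. a \<noteq> b \<and> {a, b} \<notin> snd (S ! i) \<longrightarrow> {a, b} \<notin> E)"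
    using S unfolding merge_sequence_def by - (elim conjE, assumption)+
  have finV: "finite V" using G unfolding simple_graph_def by blast
  have ne: "min i m < length S" for i using S_ne unfolding m_def by (simp add: min_less_iff_disj)
  have part: "partition_on V (P i)" for i
    using S_part ne unfolding P_def by blast
  have P0: "P 0 = {{v} | v. v \<in> V}" using S_first unfolding P_def by simp
  have Pm: "P i = {V}" if "m \<le> i" for i
    using that S_last unfolding P_def m_def by (simp add: min.absorb2)
  have R_Suc: "R i \<subseteq> R (Suc i)" for i
  proof (cases "i < m")
    case True
    have "Suc i < length S" using True unfolding m_def by simp
    then have "snd (S ! (Suc i - 1)) \<subseteq> snd (S ! Suc i)"
      using S_incr by blast
    then show ?thesis unfolding R_def using True by (simp add: min_def)
  qed (simp add: R_def min_def)
  have R_mono: "R i \<subseteq> R j" if "i \<le> j" for i j using R_Suc that by (rule lift_Suc_mono_le)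
  define cls where "cls i v = \<Union>{X \<in> P i. v \<in> X}" for i v
  have cls_P: "cls i v \<in> P i" "v \<in> cls i v" if v: "v \<in> V" for i v
  proof -
    obtain X where "X \<in> P i" "v \<in> X" using part[of i] v unfolding partition_on_def by blast
    then show "cls i v \<in> P i" "v \<in> cls i v" unfolding cls_def using partition_class[OF part] by auto
  qed
  have cls_unique: "cls i v = X" if "X \<in> P i" "v \<in> X" for X i v
    unfolding cls_def using partition_class[OF part that] .
  have cls_sub: "cls i v \<subseteq> V" if "v \<in> V" for i v
    using cls_P(1)[OF that] part[of i] unfolding partition_on_def by blast
  have cls_Suc: "cls i v \<subseteq> cls (Suc i) v" if v: "v \<in> V" for i v
  proof (cases "i < m")
    case True
    have "Suc i < length S" using True unfolding m_def by simp
    then have "\<forall>B\<in>fst (S ! Suc i). \<exists>Q \<subseteq> fst (S ! (Suc i - 1)). B = \<Union>Q"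
      using S_coarser by blast
    then have "\<forall>B\<in>P (Suc i). \<exists>Q \<subseteq> P i. B = \<Union>Q"
      unfolding P_def using True by (simp add: min_def)
    from bspec[OF this cls_P(1)[OF v]] obtain Q where Q: "Q \<subseteq> P i" "cls (Suc i) v = \<Union>Q"
      by blast
    then obtain X where "X \<in> Q" "v \<in> X" using cls_P(2)[OF v, of "Suc i"] by blast
    moreover from this have "cls i v = X" using Q(1) cls_unique by blast
    ultimately show ?thesis using Q(2) by blast
  qed (simp add: cls_def P_def min_def)
  have cls_mono: "cls i v \<subseteq> cls j v" if "v \<in> V" "i \<le> j" for i j v
    using lift_Suc_mono_le[of "\<lambda>i. cls i v" i j] cls_Suc[OF that(1)] that(2) by simp
  have hom: "{a', b'} \<in> E"
    if "a \<in> V" "b \<in> V" "a' \<in> cls i a" "b' \<in> cls i b" "a \<noteq> b" "a' \<noteq> b'"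
      "{a, b} \<notin> R i" "{a', b'} \<notin> R i" "{a, b} \<in> E" for a b a' b' i
  proof -
    have "(\<forall>x\<in>cls i a. \<forall>y\<in>cls i b. x \<noteq> y \<and> {x, y} \<notin> R i \<longrightarrow> {x, y} \<in> E) \<or>
        (\<forall>x\<in>cls i a. \<forall>y\<in>cls i b. x \<noteq> y \<and> {x, y} \<notin> R i \<longrightarrow> {x, y} \<notin> E)"
      using bspec[OF bspec[OF mp[OF spec[OF S_hom] ne[of i]] cls_P(1)[OF that(1), of i, unfolded P_def]]
          cls_P(1)[OF that(2), of i, unfolded P_def]] unfolding R_def .
    then show ?thesis using that(3-9) cls_P(2)[OF that(1), of i] cls_P(2)[OF that(2), of i] by blast
  qed
  have wid: "card (cls i ` {u \<in> V. u = v \<or> {v, u} \<in> R (Suc i) \<or>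
      (\<exists>w\<in>V. {v, w} \<in> R (Suc i) \<and> {w, u} \<in> R (Suc i))}) \<le> k" (is "card (cls i ` ?B) \<le> k")
    if v: "v \<in> V" for v i
  proof (cases "i < m")
    case False
    \<comment> \<open>From step \<open>m\<close> on, \<open>V\<close> is the only part, and a count
      of one is within the bound since \<open>0 < k\<close>.\<close>
    then have "cls i ` ?B \<subseteq> {V}" using cls_P(1) Pm[of i] by fastforce
    then have "card (cls i ` ?B) \<le> 1" using card_mono[of "{V}"] by fastforce
    then show ?thesis using k by simp
  next
    case True
    let ?h = "\<lambda>j v. card {X \<in> fst (S ! (j - 1)). X \<inter> dist_ball (snd (S ! j)) 2 v \<noteq> {}}"
    let ?A = "{?h j v | j v. 0 < j \<and> j < length S \<and> v \<in> V}"
    have len: "Suc i < length S" using True unfolding m_def by simp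
    have PR: "fst (S ! (Suc i - 1)) = P i" "snd (S ! Suc i) = R (Suc i)"
      using True unfolding P_def R_def by (auto simp: min_def)
    have "?A \<subseteq> (\<lambda>(j, v). ?h j v) ` ({..<length S} \<times> V)" by auto
    \<comment> \<open>\<open>Sup\<close> of a set of naturals is an upper bound only if the set is
      bounded.\<close>
    then have "finite ?A" using finV by (meson finite_SigmaI finite_imageI finite_lessThan finite_subset)
    moreover have "?h (Suc i) v \<in> ?A" using len v by blast
    ultimately have "?h (Suc i) v \<le> Sup ?A" by (intro le_cSup_finite)
    then have le: "?h (Suc i) v \<le> k" using w unfolding radius_width_def by simp
    have "finite (P i)" using part[of i] finV finite_elements by blast
    moreover have "?B \<subseteq> dist_ball (R (Suc i)) 2 v" by (auto simp: numeral_2_eq_2)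
    then have "cls i ` ?B \<subseteq> {X \<in> P i. X \<inter> dist_ball (R (Suc i)) 2 v \<noteq> {}}"
      using cls_P by blast
    ultimately have "card (cls i ` ?B) \<le> card {X \<in> P i. X \<inter> dist_ball (R (Suc i)) 2 v \<noteq> {}}"
      by (intro card_mono) auto
    then show ?thesis using le unfolding PR by simp
  qed
  have "merge_chain V (\<lambda>a b. {a, b} \<in> E) cls (\<lambda>i a b. {a, b} \<in> R i) m k"
  proof
    show "finite V" by (fact finV)
    show "{b, a} \<in> E" if "{a, b} \<in> E" for a b using that by (simp add: insert_commute)
    show "{a, a} \<notin> E" for a using G unfolding simple_graph_def by (auto simp: doubleton_eq_iff)
    show "cls i u = cls i v" if "v \<in> V" "u \<in> cls i v" for i u v
      using cls_unique[OF cls_P(1)[OF that(1)] that(2)] .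
    show "cls 0 v = {v}" if "v \<in> V" for v using cls_unique[of "{v}" 0 v] P0 that by auto
    show "cls m v = V" if "v \<in> V" for v using cls_unique[of V m v] Pm that by auto
    show "{b, a} \<in> R i" if "{a, b} \<in> R i" for i a b using that by (simp add: insert_commute)
    show "{a, b} \<in> R j" if "{a, b} \<in> R i" "i \<le> j" for i j a b using that R_mono by blast
  qed (fact cls_sub cls_P(2) cls_mono hom wid)+
  then show ?thesis unfolding cls_def P_def R_def .
qed

section \<open>Clique and chromatic numbers, and the final bound\<close>

lemma chromatic_number_le:
  assumes "\<forall>v\<in>V. f v < (c::nat)" "\<forall>a\<in>V. \<forall>b\<in>V. {a, b} \<in> E \<longrightarrow> f a \<noteq> f b"
  shows "chromatic_number V E \<le> c"
  unfolding chromatic_number_def using assms by (intro cInf_lower) auto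

lemma clique_card_le:
  assumes "finite V" "C \<subseteq> V" "\<forall>a\<in>C. \<forall>b\<in>C. a \<noteq> b \<longrightarrow> {a, b} \<in> E"
  shows "card C \<le> clique_number V E"
proof -
  let ?A = "{card C | C. C \<subseteq> V \<and> (\<forall>a\<in>C. \<forall>b\<in>C. a \<noteq> b \<longrightarrow> {a, b} \<in> E)}"
  have "?A \<subseteq> card ` Pow V" by auto
  then have "finite ?A" using assms(1) by (meson finite_Pow_iff finite_imageI finite_subset)
  then show ?thesis unfolding clique_number_def using assms(2,3) by (intro le_cSup_finite) auto
qed

theorem theorem1p2:
  fixes V :: "'a set" and E :: "'a set set" and k t :: nat
  assumes "0 < k" and "0 < t"
    and "simple_graph V E"
    and "merge_width 2 V E \<le> k"
    and "clique_number V E \<le> t"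
  shows "chromatic_number V E \<le> fact (t + 1) * k ^ (2 * t - 2)"
proof (cases "V = {}")
  case True
  \<comment> \<open>The empty vertex set has no merge sequence, as \<open>{{}}\<close> is not a
    partition, so it is coloured directly.\<close>
  then show ?thesis by (intro chromatic_number_le) auto
next
  case False
  have "{radius_width V 2 S | S. merge_sequence V E S} \<noteq> {}"
    using merge_sequence_exists[OF assms(3) False] by blast
  then have "merge_width 2 V E \<in> {radius_width V 2 S | S. merge_sequence V E S}"
    unfolding merge_width_def by (rule Inf_nat_def1)
  then obtain S where S: "merge_sequence V E S" "radius_width V 2 S \<le> k" using assms(4) by auto
  interpret merge_chain V "\<lambda>a b. {a, b} \<in> E" "\<lambda>i v. \<Union>{X \<in> fst (S ! min i (length S - 1)). v \<in> X}"
    "\<lambda>i a b. {a, b} \<in> snd (S ! min i (length S - 1))" "length S - 1" k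
    using merge_sequence_chain[OF assms(3) S assms(1)] .
  obtain s where s: "t = Suc s" using assms(2) gr0_implies_Suc by blast
  have "colorable V (fact (s + 2) * k ^ (2 * s))"
  proof (rule chi_bound[OF assms(1) order_refl])
    fix C assume "C \<subseteq> V" "clique C"
    then have "card C \<le> clique_number V E" unfolding clique_def by (intro clique_card_le finV)
    then show "card C \<le> Suc s" using assms(5) s by simp
  qed
  then have "chromatic_number V E \<le> fact (s + 2) * k ^ (2 * s)"
    unfolding colorable_def using chromatic_number_le by blast
  then show ?thesis unfolding s by simp
qed

end
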